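(* For each positive integer $n$ let $R_{n,L}$ be the Hasse diagram, regarded as a graph, of the lattice obtained from the rooted tree $T_n$ of restricted growth functions of length $n$ by adding one new bottom vertex $\epsilon$ and joining $\epsilon$ by an edge to each vertex in the bottom level of $T_n$. Let $\beta_n: R_{n+1,L}\to R_{n,L}$ be the map that is the identity on the copy of $T_n$ in the top part of $R_{n+1,L}$, sends each vertex of $T_{n+1}$ outside this copy to the vertex of $T_n$ immediately above it (so that the edge joining them goes to the loop at that vertex), and sends $\epsilon$ to $\epsilon$. Then $\beta_n$ is a monotone epimorphism of graphs for every $n\ge 1$.
   Context: A restricted growth function (RGF) of length $n$ is a sequence $a_1\cdots a_n$ of positive integers with $a_1=1$ and $a_i\le 1+\max\{a_1,\dots,a_{i-1}\}$ for $i\ge 2$. The tree $T_n$ has as vertices the empty word (the root, at the top) and all RGFs of length at most $n$; a word $w$ is joined to each word $wa$ of length at most $n$ (the edge being labelled $a$), with $wa$ lying below $w$. The bottom level of $T_n$ consists of the RGFs of length exactly $n$. The tree $T_n$ is naturally contained in $T_{n+1}$ as the set of words of length at most $n$. A graph $A=(V(A),E(A))$ has $E(A)\subseteq V(A)^2$ reflexive and symmetric, so every vertex carries a loop. A homomorphism of graphs is a map on vertices sending edges to edges; an epimorphism is a homomorphism that is surjective on vertices and on edges. An epimorphism between finite graphs is monotone if the preimage of every connected set of vertices is connected. *)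

theory Defs
  imports Main "HOL-Library.Sublist"
begin

record 'a graph =
  verts :: "'a set"
  edges :: "('a \<times> 'a) set"

definition is_graph :: "'a graph \<Rightarrow> bool" where
  "is_graph A \<longleftrightarrow> edges A \<subseteq> verts A \<times> verts A \<and> refl_on (verts A) (edges A) \<and> sym (edges A)"

definition homomorphism :: "('a \<Rightarrow> 'b) \<Rightarrow> 'a graph \<Rightarrow> 'b graph \<Rightarrow> bool" where
  "homomorphism f A B \<longleftrightarrow> is_graph A \<and> is_graph B \<and>
     f ` verts A \<subseteq> verts B \<and> (\<forall>(x, y) \<in> edges A. (f x, f y) \<in> edges B)"

definition epimorphism :: "('a \<Rightarrow> 'b) \<Rightarrow> 'a graph \<Rightarrow> 'b graph \<Rightarrow> bool" where
  "epimorphism f A B \<longleftrightarrow> homomorphism f A B \<and>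
     f ` verts A = verts B \<and> map_prod f f ` edges A = edges B"

text \<open>A set of vertices is connected if any two of its members are joined by a walk that stays
  inside the set. The empty set counts as connected.\<close>

definition connected_in :: "'a graph \<Rightarrow> 'a set \<Rightarrow> bool" where
  "connected_in A S \<longleftrightarrow> S \<subseteq> verts A \<and>
     (\<forall>x\<in>S. \<forall>y\<in>S. (x, y) \<in> (edges A \<inter> S \<times> S)\<^sup>*)"

definition monotone_epimorphism :: "('a \<Rightarrow> 'b) \<Rightarrow> 'a graph \<Rightarrow> 'b graph \<Rightarrow> bool" where
  "monotone_epimorphism f A B \<longleftrightarrow>
     finite (verts A) \<and> finite (verts B) \<and> epimorphism f A B \<and>
     (\<forall>S. connected_in B S \<longrightarrow> connected_in A {x \<in> verts A. f x \<in> S})"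

definition covers :: "'a set \<Rightarrow> ('a \<times> 'a) set \<Rightarrow> ('a \<times> 'a) set" where
  "covers V r = {(x, y). x \<in> V \<and> y \<in> V \<and> (x, y) \<in> r \<and> x \<noteq> y \<and>
     (\<forall>z\<in>V. (x, z) \<in> r \<and> (z, y) \<in> r \<longrightarrow> z = x \<or> z = y)}"

text \<open>The Hasse diagram of an order \<open>r\<close> on \<open>V\<close>, where \<open>(x, y) \<in> r\<close> means that \<open>x\<close> is below \<open>y\<close>,
  regarded as an undirected graph with a loop at every vertex.\<close>

definition hasse_graph :: "'a set \<Rightarrow> ('a \<times> 'a) set \<Rightarrow> 'a graph" where
  "hasse_graph V r = \<lparr>verts = V, edges = Id_on V \<union> covers V r \<union> (covers V r)\<inverse>\<rparr>"

definition is_rgf :: "nat list \<Rightarrow> bool" where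
  "is_rgf w \<longleftrightarrow> w \<noteq> [] \<and> (\<forall>i<length w. 0 < w ! i) \<and> w ! 0 = 1 \<and>
     (\<forall>i. 0 < i \<and> i < length w \<longrightarrow> w ! i \<le> 1 + Max (set (take i w)))"

definition tree_verts :: "nat \<Rightarrow> nat list set" where
  "tree_verts n = {[]} \<union> {w. is_rgf w \<and> length w \<le> n}"

datatype vertex = Word "nat list" | Eps

definition L_verts :: "nat \<Rightarrow> vertex set" where
  "L_verts n = insert Eps (Word ` tree_verts n)"

text \<open>The edges of the tree with the new bottom vertex attached, each directed upwards.\<close>

definition L_up :: "nat \<Rightarrow> (vertex \<times> vertex) set" where
  "L_up n = {(Word (w @ [a]), Word w) | w a. w \<in> tree_verts n \<and> w @ [a] \<in> tree_verts n}
     \<union> {(Eps, Word w) | w. w \<in> tree_verts n \<and> length w = n}"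

definition L_le :: "nat \<Rightarrow> (vertex \<times> vertex) set" where
  "L_le n = {(x, y). x \<in> L_verts n \<and> y \<in> L_verts n \<and> (x, y) \<in> (L_up n)\<^sup>*}"

definition R_L :: "nat \<Rightarrow> vertex graph" where
  "R_L n = hasse_graph (L_verts n) (L_le n)"

fun \<beta> :: "nat \<Rightarrow> vertex \<Rightarrow> vertex" where
  "\<beta> n Eps = Eps"
| "\<beta> n (Word w) = (if w \<in> tree_verts n then Word w else Word (butlast w))"

text \<open>Consistency checks: the order is that of a lattice, and the edges of its Hasse diagram are
  exactly the edges used to generate it.\<close>

lemma tree_verts_prefix:
  assumes "v \<in> tree_verts n" "prefix u v"
  shows "u \<in> tree_verts n"
proof (cases "u = []")
  case True then show ?thesis by (simp add: tree_verts_def)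
next
  case False
  from assms(2) obtain t where v: "v = u @ t" by (auto simp: prefix_def)
  have r: "is_rgf v" "length v \<le> n" using assms False v by (auto simp: tree_verts_def)
  have "is_rgf u" unfolding is_rgf_def
  proof (intro conjI allI impI)
    show "u \<noteq> []" by fact
    show "u ! 0 = 1" using r False by (auto simp: is_rgf_def v nth_append)
    fix i
    { assume i: "i < length u"
      have "0 < v ! i" using r i by (auto simp: is_rgf_def v)
      then show "0 < u ! i" using i by (simp add: v nth_append) }
    { assume i: "0 < i \<and> i < length u"
      have "v ! i \<le> 1 + Max (set (take i v))" using r i by (auto simp: is_rgf_def v)
      then show "u ! i \<le> 1 + Max (set (take i u))" using i by (simp add: v nth_append) }
  qed
  then show ?thesis using r by (simp add: tree_verts_def v)
qed

lemma tree_verts_extend: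
  assumes "w \<in> tree_verts n" "length w < n"
  shows "w @ [1] \<in> tree_verts n"
  using assms by (auto simp: tree_verts_def is_rgf_def nth_append less_Suc_eq)

lemma tree_verts_length: "w \<in> tree_verts n \<Longrightarrow> length w \<le> n"
  by (auto simp: tree_verts_def)

lemma L_up_chain:
  assumes "u @ t \<in> tree_verts n"
  shows "(Word (u @ t), Word u) \<in> (L_up n)\<^sup>*"
  using assms
proof (induction t rule: rev_induct)
  case Nil then show ?case by simp
next
  case (snoc a t)
  have "u @ t \<in> tree_verts n" by (rule tree_verts_prefix[OF snoc.prems]) (simp add: prefix_def)
  moreover from this have "(Word (u @ t @ [a]), Word (u @ t)) \<in> L_up n"
    using snoc.prems by (auto simp: L_up_def)
  ultimately show ?case using snoc.IH by (meson converse_rtrancl_into_rtrancl)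
qed

lemma tree_verts_deep:
  assumes "w \<in> tree_verts n"
  shows "\<exists>t. w @ t \<in> tree_verts n \<and> length (w @ t) = n"
  using assms
proof (induction "n - length w" arbitrary: w)
  case 0 then show ?case using tree_verts_length[OF 0(2)] by (intro exI[of _ "[]"]) simp
next
  case (Suc k)
  then have "w @ [1] \<in> tree_verts n" by (intro tree_verts_extend) auto
  moreover have "k = n - length (w @ [1])" using Suc(2) by simp
  ultimately obtain t where
    "(w @ [1]) @ t \<in> tree_verts n \<and> length ((w @ [1]) @ t) = n" using Suc(1) by blast
  then show ?case by (intro exI[of _ "[1] @ t"]) simp
qed

lemma L_le_iff:
  "(x, y) \<in> L_le n \<longleftrightarrow> x \<in> L_verts n \<and> y \<in> L_verts n \<and>
     (x = Eps \<or> (\<exists>v w. x = Word v \<and> y = Word w \<and> prefix w v))" (is "_ = ?R x y")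
proof
  assume "(x, y) \<in> L_le n"
  then have v: "x \<in> L_verts n" "y \<in> L_verts n" and st: "(x, y) \<in> (L_up n)\<^sup>*"
    by (auto simp: L_le_def)
  from st have "x = Eps \<or> (\<exists>v w. x = Word v \<and> y = Word w \<and> prefix w v)"
  proof (induction rule: rtrancl_induct)
    case base then show ?case by (cases x) auto
  next
    case (step y z) then show ?case
      by (auto simp: L_up_def) (metis append_prefixD)+
  qed
  with v show "?R x y" by simp
next
  assume R: "?R x y"
  have "(x, y) \<in> (L_up n)\<^sup>*"
  proof (cases x)
    case (Word v)
    with R show ?thesis by (auto simp: prefix_def L_verts_def intro!: L_up_chain)
  next
    case Eps
    show ?thesis
    proof (cases y)
      case (Word w)
      then have "w \<in> tree_verts n" using R by (auto simp: L_verts_def)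
      with tree_verts_deep obtain t where t: "w @ t \<in> tree_verts n" "length (w @ t) = n" by blast
      then have "(Eps, Word (w @ t)) \<in> L_up n" by (auto simp: L_up_def)
      with L_up_chain[OF t(1)] show ?thesis using Word Eps
        by (meson converse_rtrancl_into_rtrancl)
    qed (simp add: Eps)
  qed
  with R show "(x, y) \<in> L_le n" by (simp add: L_le_def)
qed

lemma L_le_lattice:
  shows "partial_order_on (L_verts n) (L_le n)"
    and "x \<in> L_verts n \<Longrightarrow> y \<in> L_verts n \<Longrightarrow>
      \<exists>s\<in>L_verts n. \<forall>z\<in>L_verts n. (s, z) \<in> L_le n \<longleftrightarrow> (x, z) \<in> L_le n \<and> (y, z) \<in> L_le n"
    and "x \<in> L_verts n \<Longrightarrow> y \<in> L_verts n \<Longrightarrow>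
      \<exists>s\<in>L_verts n. \<forall>z\<in>L_verts n. (z, s) \<in> L_le n \<longleftrightarrow> (z, x) \<in> L_le n \<and> (z, y) \<in> L_le n"
proof -
  show "partial_order_on (L_verts n) (L_le n)"
    unfolding partial_order_on_def preorder_on_def refl_on_def trans_def antisym_def
    by (auto simp: L_le_iff L_verts_def)
  assume xy: "x \<in> L_verts n" "y \<in> L_verts n"
  show "\<exists>s\<in>L_verts n. \<forall>z\<in>L_verts n. (s, z) \<in> L_le n \<longleftrightarrow> (x, z) \<in> L_le n \<and> (y, z) \<in> L_le n"
  proof (cases "x = Eps \<or> y = Eps")
    case True
    then show ?thesis
    proof
      assume "x = Eps" with xy show ?thesis by (intro bexI[of _ y]) (auto simp: L_le_iff)
    next
      assume "y = Eps" with xy show ?thesis by (intro bexI[of _ x]) (auto simp: L_le_iff)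
    qed
  next
    case False
    then obtain v w where vw: "x = Word v" "y = Word w" by (metis vertex.exhaust)
    then have "longest_common_prefix v w \<in> tree_verts n"
      using xy tree_verts_prefix[OF _ longest_common_prefix_prefix1, of v n w]
      by (auto simp: L_verts_def)
    then show ?thesis using xy vw
      by (intro bexI[of _ "Word (longest_common_prefix v w)"])
        (auto simp: L_le_iff L_verts_def intro: longest_common_prefix_max_prefix
          prefix_order.trans[OF _ longest_common_prefix_prefix1]
          prefix_order.trans[OF _ longest_common_prefix_prefix2])
  qed
  show "\<exists>s\<in>L_verts n. \<forall>z\<in>L_verts n. (z, s) \<in> L_le n \<longleftrightarrow> (z, x) \<in> L_le n \<and> (z, y) \<in> L_le n"
  proof -
    consider "(x, y) \<in> L_le n" | "(y, x) \<in> L_le n"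
      | "(x, y) \<notin> L_le n" "(y, x) \<notin> L_le n" by blast
    then show ?thesis
    proof cases
      case 1 with xy show ?thesis by (intro bexI[of _ x]) (auto simp: L_le_iff)
    next
      case 2 with xy show ?thesis by (intro bexI[of _ y]) (auto simp: L_le_iff)
    next
      case 3
      then show ?thesis using xy
        by (intro bexI[of _ Eps]) (auto simp: L_le_iff L_verts_def dest: prefix_same_cases)
    qed
  qed
qed

lemma covers_L_le: "covers (L_verts n) (L_le n) = L_up n"
proof (intro equalityI subrelI)
  fix x y assume c: "(x, y) \<in> covers (L_verts n) (L_le n)"
  then have st: "(x, y) \<in> (L_up n)\<^sup>*" and ne: "x \<noteq> y"
    by (auto simp: covers_def L_le_def)
  then obtain z where z: "(x, z) \<in> L_up n" "(z, y) \<in> (L_up n)\<^sup>*"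
    by (meson converse_rtranclE)
  have zV: "z \<in> L_verts n" "z \<noteq> x" using z(1) by (auto simp: L_up_def L_verts_def)
  have "(x, z) \<in> L_le n" "(z, y) \<in> L_le n"
    using c z zV by (auto simp: covers_def L_le_def)
  with c zV have "z = y" by (auto simp: covers_def)
  with z show "(x, y) \<in> L_up n" by simp
next
  fix x y assume u: "(x, y) \<in> L_up n"
  then have V: "x \<in> L_verts n" "y \<in> L_verts n" "x \<noteq> y" by (auto simp: L_up_def L_verts_def)
  have "z = x \<or> z = y" if "z \<in> L_verts n" "(x, z) \<in> L_le n" "(z, y) \<in> L_le n" for z
    using u that
    by (auto simp: L_up_def L_le_iff L_verts_def prefix_def append_eq_append_conv2
        append_eq_Cons_conv Cons_eq_append_conv dest!: tree_verts_length)
  with u V show "(x, y) \<in> covers (L_verts n) (L_le n)" by (auto simp: covers_def L_le_def)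
qed

end

theory Submission
  imports Defs
begin

text \<open>
  The map \<open>\<beta> n\<close> is a retraction of the vertex set of \<open>R_L (n + 1)\<close> onto that of \<open>R_L n\<close>, and it
  moves each vertex along an edge (\<open>beta_edge\<close>): a word of length \<open>n + 1\<close> goes to its parent, every
  other vertex stays. So the fibre over \<open>v\<close> is a star of \<open>R_L (n + 1)\<close> with centre \<open>v\<close>, and in
  particular it is connected.

  For a map of graphs that is onto on edges, connected fibres are enough for monotonicity
  (\<open>connected_in_preimage\<close>): a walk in a connected set lifts edge by edge, and where two
  consecutive lifted edges do not meet, their ends lie in one fibre and can be joined inside it.

  That \<open>\<beta> n\<close> is a homomorphism and onto on edges is seen on the generating upward edges. The only
  ones that move are \<open>(w @ [a], w)\<close> with \<open>length w = n\<close>, which becomes a loop, and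
  \<open>(Eps, w @ [a])\<close> with \<open>length w = n\<close>, which becomes \<open>(Eps, w)\<close>. Conversely \<open>(Eps, w)\<close> has a lift
  because \<open>w @ [1]\<close> is always a restricted growth function. The vertex sets are finite because the
  \<open>i\<close>-th letter of a restricted growth function is at most \<open>i\<close>.
\<close>

section \<open>Connected sets and Hasse graphs\<close>

lemma connected_in_star:
  assumes "is_graph A" "S \<subseteq> verts A" "c \<in> S" "\<And>x. x \<in> S \<Longrightarrow> (x, c) \<in> edges A"
  shows "connected_in A S"
  unfolding connected_in_def
proof (intro conjI ballI)
  fix x y assume "x \<in> S" "y \<in> S"
  moreover have "(c, y) \<in> edges A"
    using assms \<open>y \<in> S\<close> by (auto simp: is_graph_def dest: symD)
  ultimately have "(x, c) \<in> edges A \<inter> S \<times> S" "(c, y) \<in> edges A \<inter> S \<times> S"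
    using assms by auto
  then show "(x, y) \<in> (edges A \<inter> S \<times> S)\<^sup>*"
    by (meson converse_rtrancl_into_rtrancl r_into_rtrancl)
qed (fact assms)

text \<open>Induction along a walk in \<open>S\<close> that starts at \<open>f x\<close>. The claim is made for all points \<open>y\<close> of
  the fibre over the current vertex, so that the induction hypothesis applies to the initial point
  of the next lifted edge, which cannot be chosen.\<close>

lemma connected_in_preimage:
  assumes graph: "is_graph A"
    and onto: "map_prod f f ` edges A = edges B"
    and fibres: "\<And>b. b \<in> verts B \<Longrightarrow> connected_in A {x \<in> verts A. f x = b}"
    and S: "connected_in B S"
  shows "connected_in A {x \<in> verts A. f x \<in> S}"
proof -
  define P where "P = {x \<in> verts A. f x \<in> S}"
  have fibre: "(x, y) \<in> (edges A \<inter> P \<times> P)\<^sup>*" if "x \<in> P" "y \<in> P" "f x = f y" for x y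
  proof -
    let ?F = "{z \<in> verts A. f z = f y}"
    have "f y \<in> verts B" using S that by (auto simp: connected_in_def P_def)
    then have "(x, y) \<in> (edges A \<inter> ?F \<times> ?F)\<^sup>*"
      using fibres that by (auto simp: connected_in_def P_def)
    moreover have "edges A \<inter> ?F \<times> ?F \<subseteq> edges A \<inter> P \<times> P"
      using that by (auto simp: P_def)
    ultimately show ?thesis using rtrancl_mono by blast
  qed
  have walk: "\<forall>y\<in>P. f y = t \<longrightarrow> (x, y) \<in> (edges A \<inter> P \<times> P)\<^sup>*"
    if "x \<in> P" "(f x, t) \<in> (edges B \<inter> S \<times> S)\<^sup>*" for x t
    using that(2)
  proof (induction rule: rtrancl_induct)
    case base
    show ?case using fibre \<open>x \<in> P\<close> by auto
  next
    case (step s t)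
    have "(s, t) \<in> map_prod f f ` edges A" using step.hyps onto by simp
    then obtain a b where ab: "(a, b) \<in> edges A" "s = f a" "t = f b" by auto
    then have "a \<in> P" "b \<in> P"
      using step.hyps graph by (auto simp: is_graph_def P_def)
    show ?case
    proof (intro ballI impI)
      fix y assume "y \<in> P" "f y = t"
      have "(x, a) \<in> (edges A \<inter> P \<times> P)\<^sup>*" using step.IH ab \<open>a \<in> P\<close> by blast
      moreover have "(a, b) \<in> edges A \<inter> P \<times> P" using ab \<open>a \<in> P\<close> \<open>b \<in> P\<close> by blast
      moreover have "(b, y) \<in> (edges A \<inter> P \<times> P)\<^sup>*"
        using fibre ab \<open>b \<in> P\<close> \<open>y \<in> P\<close> \<open>f y = t\<close> by simp
      ultimately show "(x, y) \<in> (edges A \<inter> P \<times> P)\<^sup>*"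
        by (meson rtrancl.rtrancl_into_rtrancl rtrancl_trans)
    qed
  qed
  have "(x, y) \<in> (edges A \<inter> P \<times> P)\<^sup>*" if "x \<in> P" "y \<in> P" for x y
  proof -
    have "(f x, f y) \<in> (edges B \<inter> S \<times> S)\<^sup>*"
      using S that by (auto simp: connected_in_def P_def)
    then show ?thesis using walk that by blast
  qed
  then have "connected_in A P" by (auto simp: connected_in_def P_def)
  then show ?thesis by (simp add: P_def)
qed

lemma is_graph_hasse_graph: "is_graph (hasse_graph V r)"
  by (auto simp: is_graph_def hasse_graph_def covers_def refl_on_def sym_def)

lemma verts_R_L: "verts (R_L n) = L_verts n"
  by (simp add: R_L_def hasse_graph_def)

lemma edges_R_L: "edges (R_L n) = Id_on (L_verts n) \<union> L_up n \<union> (L_up n)\<inverse>"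
  by (simp add: R_L_def hasse_graph_def covers_L_le)

section \<open>Restricted growth functions\<close>

lemma rgf_nth_le:
  assumes "is_rgf w" "i < length w"
  shows "w ! i \<le> i + 1"
  using assms(2)
proof (induction i rule: less_induct)
  case (less i)
  show ?case
  proof (cases "i = 0")
    case True
    then show ?thesis using assms(1) by (simp add: is_rgf_def)
  next
    case False
    have "x \<le> i" if x: "x \<in> set (take i w)" for x
    proof -
      obtain j where "j < i" "x = w ! j"
        using x less.prems by (auto simp: in_set_conv_nth)
      then show ?thesis using less.IH[of j] less.prems by simp
    qed
    moreover have "set (take i w) \<noteq> {}" using False less.prems by auto
    ultimately have "Max (set (take i w)) \<le> i" by simp
    moreover have "w ! i \<le> 1 + Max (set (take i w))"
      using assms(1) False less.prems by (simp add: is_rgf_def)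
    ultimately show ?thesis by simp
  qed
qed

lemma finite_tree_verts: "finite (tree_verts n)"
proof (rule finite_subset)
  show "tree_verts n \<subseteq> {w. set w \<subseteq> {..n} \<and> length w \<le> n}"
    by (fastforce simp: tree_verts_def in_set_conv_nth dest: rgf_nth_le)
  show "finite {w. set w \<subseteq> {..n} \<and> length w \<le> n}"
    by (rule finite_lists_length_le) simp
qed

lemma finite_L_verts: "finite (L_verts n)"
  by (simp add: L_verts_def finite_tree_verts)

lemma tree_verts_Suc_iff: "w \<in> tree_verts n \<longleftrightarrow> w \<in> tree_verts (Suc n) \<and> length w \<le> n"
  by (auto simp: tree_verts_def)

lemma L_verts_Suc: "L_verts n \<subseteq> L_verts (Suc n)"
  by (auto simp: L_verts_def tree_verts_Suc_iff[of _ n])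

lemma new_word_cases:
  assumes "w \<in> tree_verts (Suc n)" "w \<notin> tree_verts n"
  obtains u a where "w = u @ [a]" "u \<in> tree_verts n" "length u = n"
proof -
  have len: "length w = Suc n"
    using assms tree_verts_Suc_iff[of w n] tree_verts_length[OF assms(1)] by auto
  then obtain u a where w: "w = u @ [a]" by (cases w rule: rev_cases) auto
  have "u \<in> tree_verts (Suc n)"
    using tree_verts_prefix[OF assms(1)] w by (simp add: prefix_def)
  then show ?thesis using that w len tree_verts_Suc_iff[of u n] by simp
qed

section \<open>The retraction\<close>

lemma beta_L_verts: "x \<in> L_verts (Suc n) \<Longrightarrow> \<beta> n x \<in> L_verts n"
  by (cases x) (auto simp: L_verts_def elim!: new_word_cases)

lemma beta_id: "x \<in> L_verts n \<Longrightarrow> \<beta> n x = x"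
  by (auto simp: L_verts_def)

lemma beta_edge:
  assumes "x \<in> L_verts (Suc n)"
  shows "(x, \<beta> n x) \<in> edges (R_L (Suc n))"
proof (cases "x \<in> L_verts n")
  case True
  then show ?thesis using assms by (simp add: beta_id edges_R_L Id_on_iff)
next
  case False
  then obtain w where w: "x = Word w" "w \<in> tree_verts (Suc n)" "w \<notin> tree_verts n"
    using assms by (auto simp: L_verts_def)
  then obtain u a where "w = u @ [a]" "u \<in> tree_verts n" by (elim new_word_cases)
  then show ?thesis using w by (auto simp: edges_R_L L_up_def tree_verts_Suc_iff[of u n])
qed

lemma beta_L_up:
  assumes "(x, y) \<in> L_up (Suc n)"
  shows "(\<beta> n x, \<beta> n y) \<in> Id_on (L_verts n) \<union> L_up n"
proof -
  from assms consider
      (tree) w a where "x = Word (w @ [a])" "y = Word w"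
        "w \<in> tree_verts (Suc n)" "w @ [a] \<in> tree_verts (Suc n)"
    | (bottom) w where "x = Eps" "y = Word w" "w \<in> tree_verts (Suc n)" "length w = Suc n"
    by (auto simp: L_up_def)
  then show ?thesis
  proof cases
    case tree
    have "w \<in> tree_verts n"
      using tree tree_verts_length[OF tree(4)] tree_verts_Suc_iff[of w n] by simp
    then show ?thesis using tree by (auto simp: L_up_def L_verts_def)
  next
    case bottom
    have new: "w \<notin> tree_verts n" using bottom tree_verts_length by fastforce
    with bottom obtain u a where "w = u @ [a]" "u \<in> tree_verts n" "length u = n"
      by (elim new_word_cases)
    then show ?thesis using bottom new by (auto simp: L_up_def)
  qed
qed

lemma beta_edges:
  assumes "(x, y) \<in> edges (R_L (Suc n))"
  shows "(\<beta> n x, \<beta> n y) \<in> edges (R_L n)"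
proof -
  consider "x = y" "x \<in> L_verts (Suc n)" | "(x, y) \<in> L_up (Suc n)" | "(y, x) \<in> L_up (Suc n)"
    using assms by (auto simp: edges_R_L)
  then show ?thesis
    by cases (auto simp: edges_R_L beta_L_verts dest: beta_L_up)
qed

lemma L_up_lift:
  assumes "(x, y) \<in> L_up n"
  obtains x' y' where "(x', y') \<in> L_up (Suc n)" "\<beta> n x' = x" "\<beta> n y' = y"
proof -
  from assms consider
      (tree) w a where "x = Word (w @ [a])" "y = Word w"
        "w \<in> tree_verts n" "w @ [a] \<in> tree_verts n"
    | (bottom) w where "x = Eps" "y = Word w" "w \<in> tree_verts n" "length w = n"
    by (auto simp: L_up_def)
  then show thesis
  proof cases
    case tree
    then have "(x, y) \<in> L_up (Suc n)"
      using tree_verts_Suc_iff[of w n] tree_verts_Suc_iff[of "w @ [a]" n] by (auto simp: L_up_def)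
    then show thesis using that tree by simp
  next
    case bottom
    have "w @ [1] \<in> tree_verts (Suc n)"
      using bottom tree_verts_Suc_iff[of w n] by (intro tree_verts_extend) auto
    moreover have "w @ [1] \<notin> tree_verts n" using bottom tree_verts_length by fastforce
    ultimately show thesis
      using bottom by (intro that[of Eps "Word (w @ [1])"]) (auto simp: L_up_def)
  qed
qed

lemma beta_edges_onto: "map_prod (\<beta> n) (\<beta> n) ` edges (R_L (Suc n)) = edges (R_L n)"
proof (intro equalityI subrelI)
  fix x y assume "(x, y) \<in> map_prod (\<beta> n) (\<beta> n) ` edges (R_L (Suc n))"
  then show "(x, y) \<in> edges (R_L n)" using beta_edges by auto
next
  fix x y assume "(x, y) \<in> edges (R_L n)"
  then consider "x = y" "x \<in> L_verts n" | "(x, y) \<in> L_up n" | "(y, x) \<in> L_up n"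
    by (auto simp: edges_R_L)
  then have "\<exists>x' y'. (x', y') \<in> edges (R_L (Suc n)) \<and> \<beta> n x' = x \<and> \<beta> n y' = y"
  proof cases
    case 1
    then show ?thesis using L_verts_Suc beta_id by (fastforce simp: edges_R_L)
  next
    case 2
    then show ?thesis by (rule L_up_lift) (auto simp: edges_R_L)
  next
    case 3
    then show ?thesis by (rule L_up_lift) (auto simp: edges_R_L)
  qed
  then show "(x, y) \<in> map_prod (\<beta> n) (\<beta> n) ` edges (R_L (Suc n))" by force
qed

lemma beta_fibre_connected:
  assumes "v \<in> L_verts n"
  shows "connected_in (R_L (Suc n)) {x \<in> L_verts (Suc n). \<beta> n x = v}"
proof (rule connected_in_star)
  show "is_graph (R_L (Suc n))" by (simp add: R_L_def is_graph_hasse_graph)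
  show "v \<in> {x \<in> L_verts (Suc n). \<beta> n x = v}" using assms L_verts_Suc beta_id by auto
qed (auto simp: verts_R_L beta_edge)

theorem mainTheorem2:
  fixes n :: nat
  assumes "n \<ge> 1"
  shows "monotone_epimorphism (\<beta> n) (R_L (n + 1)) (R_L n)"
proof -
  have graph: "is_graph (R_L m)" for m by (simp add: R_L_def is_graph_hasse_graph)
  have "\<beta> n ` L_verts (Suc n) = L_verts n"
  proof
    show "\<beta> n ` L_verts (Suc n) \<subseteq> L_verts n" using beta_L_verts by blast
    show "L_verts n \<subseteq> \<beta> n ` L_verts (Suc n)"
      using L_verts_Suc beta_id by (metis image_eqI subset_iff)
  qed
  then have "epimorphism (\<beta> n) (R_L (Suc n)) (R_L n)"
    using graph beta_edges beta_edges_onto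
    by (auto simp: epimorphism_def homomorphism_def verts_R_L)
  moreover have "connected_in (R_L (Suc n)) {x \<in> verts (R_L (Suc n)). \<beta> n x \<in> S}"
    if "connected_in (R_L n) S" for S
    using connected_in_preimage[OF graph beta_edges_onto _ that] beta_fibre_connected
    by (simp add: verts_R_L)
  ultimately show ?thesis
    by (simp add: monotone_epimorphism_def verts_R_L finite_L_verts)
qed

end
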